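(* Let $\alpha^*>0$ and $\alpha_*>0$ be given constants (independent of $h$). Suppose that the function $g:=g_1/g_2:\mathbb{R}_{>0}\to\mathbb{R}_{>0}$ is surjective and that $g'(x)<0$ holds for all $x\in\mathbb{R}_{>0}$. Then there exists a constant $\kappa_1(\alpha_*,\alpha^* )>0$, independent of $h$ (that is, of $n$), such that $$\kappa<\kappa_1(\alpha_*,\alpha^* ),\qquad\text{where }\kappa:=\max\{\|\varphi'(\alpha)\|_\infty:\alpha\in\mathcal{I}\},$$ $\mathcal{I}$ is the closed real interval with endpoints $\alpha_*$ and $\alpha^*$, and $\varphi:\mathcal{I}\to\mathbb{R}^n$ maps $\alpha$ to the positive solution (for the given $n$) of the system recalled in the context.
   Context: $g_1,g_2:\mathbb{R}\to\mathbb{R}$ are functions of class $\mathcal{C}^3(\mathbb{R})$, analytic at $x=0$, such that $g_i(0)=0$, $g_i'(x)>0$, $g_i''(x)>0$ and $g_i'''(x)\ge 0$ for all $x>0$ and $i=1,2$. For an integer $n\ge 2$ put $h:=1/(n-1)$. For $\alpha>0$ consider the system in unknowns $U_1,\ldots,U_n$: $$\left\{\begin{array}{rcl} 0&=&-(U_2-U_1)+\frac{h^2}{2}g_1(U_1),\\ 0&=&-(U_{k+1}-2U_k+U_{k-1})+h^2g_1(U_k)\quad(2\le k\le n-1),\\ 0&=&-(U_{n-1}-U_n)+\frac{h^2}{2}g_1(U_n)-h\alpha\, g_2(U_n).\end{array}\right.$$ When $g$ is surjective and decreasing, it has exactly one solution in $(\mathbb{R}_{>0})^n$ for each $\alpha>0$,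 called the positive solution and denoted $\varphi(\alpha)$; $\varphi$ is differentiable in $\alpha$. $\kappa$ depends on $n$, while $\kappa_1(\alpha_*,\alpha^* )$ does not. *)

theory Defs
  imports "HOL-Analysis.Analysis"
begin

definition C3 :: "(real \<Rightarrow> real) \<Rightarrow> bool" where
  "C3 f \<longleftrightarrow>
     (\<forall>j<3. \<forall>x. ((deriv ^^ j) f) field_differentiable (at x)) \<and>
     continuous_on UNIV ((deriv ^^ 3) f)"

text \<open>Real analyticity; the library's \<open>analytic_on\<close> is about complex functions.\<close>

definition real_analytic_at :: "(real \<Rightarrow> real) \<Rightarrow> real \<Rightarrow> bool" where
  "real_analytic_at f x0 \<longleftrightarrow>
     (\<exists>r>0. \<exists>a :: nat \<Rightarrow> real. \<forall>x. \<bar>x - x0\<bar> < r \<longrightarrow> (\<lambda>i. a i * (x - x0) ^ i) sums f x)"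

definition admissible :: "(real \<Rightarrow> real) \<Rightarrow> bool" where
  "admissible f \<longleftrightarrow>
     C3 f \<and> real_analytic_at f 0 \<and> f 0 = 0 \<and>
     (\<forall>x>0. deriv f x > 0 \<and> (deriv ^^ 2) f x > 0 \<and> (deriv ^^ 3) f x \<ge> 0)"

definition mesh :: "nat \<Rightarrow> real" where
  "mesh n = 1 / (real n - 1)"

text \<open>Since \<open>n\<close> varies, a vector with entries in \<open>A\<close> is an element of \<open>{1..n} \<rightarrow>\<^sub>E A\<close>:
  its value outside \<open>{1..n}\<close> is fixed, so that vectors with equal entries are equal.\<close>

definition system_solution ::
    "(real \<Rightarrow> real) \<Rightarrow> (real \<Rightarrow> real) \<Rightarrow> nat \<Rightarrow> real \<Rightarrow> (nat \<Rightarrow> real) \<Rightarrow> bool" where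
  "system_solution g1 g2 n \<alpha> U \<longleftrightarrow>
     0 = - (U 2 - U 1) + (mesh n)\<^sup>2 / 2 * g1 (U 1) \<and>
     (\<forall>k\<in>{2..n - 1}. 0 = - (U (k + 1) - 2 * U k + U (k - 1)) + (mesh n)\<^sup>2 * g1 (U k)) \<and>
     0 = - (U (n - 1) - U n) + (mesh n)\<^sup>2 / 2 * g1 (U n) - mesh n * \<alpha> * g2 (U n)"

definition positive_solution ::
    "(real \<Rightarrow> real) \<Rightarrow> (real \<Rightarrow> real) \<Rightarrow> nat \<Rightarrow> real \<Rightarrow> (nat \<Rightarrow> real)" where
  "positive_solution g1 g2 n \<alpha> =
     (THE U. U \<in> {1..n} \<rightarrow>\<^sub>E {0<..} \<and> system_solution g1 g2 n \<alpha> U)"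

definition positive_solution_deriv ::
    "(real \<Rightarrow> real) \<Rightarrow> (real \<Rightarrow> real) \<Rightarrow> nat \<Rightarrow> real \<Rightarrow> (nat \<Rightarrow> real)" where
  "positive_solution_deriv g1 g2 n \<alpha> =
     (\<lambda>k\<in>{1..n}. deriv (\<lambda>a. positive_solution g1 g2 n a k) \<alpha>)"

definition max_norm :: "nat \<Rightarrow> (nat \<Rightarrow> real) \<Rightarrow> real" where
  "max_norm n V = Max ((\<lambda>k. \<bar>V k\<bar>) ` {1..n})"

definition is_maximum :: "real set \<Rightarrow> real \<Rightarrow> bool" where
  "is_maximum S m \<longleftrightarrow> m \<in> S \<and> (\<forall>s\<in>S. s \<le> m)"

end

theory Submission
  imports Defs
begin

text \<open>
  All equations but the last determine the vector from its left value \<open>u\<close>, so the system is a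
  scalar equation \<open>\<alpha> = A(u)\<close> with \<open>A(u) = T(u) / g\<^sub>2(U(u))\<close>. Here \<open>U(u)\<close> is the right value and
  \<open>T(u)\<close> the trapezoidal sum of \<open>g\<^sub>1\<close> along the vector, which is the discrete slope at the right end.
  All derivatives below are with respect to \<open>u\<close>, apart from those of \<open>g = g\<^sub>1 / g\<^sub>2\<close>, \<open>g\<^sub>1\<close>
  and \<open>g\<^sub>2\<close>.

  A discrete Wronskian inequality (\<open>wronskian_nonneg\<close>), which uses only the convexity of \<open>g\<^sub>1\<close>, gives
  \<open>T' / T \<le> g\<^sub>1'(U) U' / g\<^sub>1(U)\<close> and therefore
  \<open>A' / A \<le> U' g'(U) / g(U) < 0\<close>.
  So \<open>A\<close> is a decreasing bijection of the positive half-line, and its inverse is differentiable.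
  The components of the derivative of the solution with respect to \<open>\<alpha>\<close> are the sensitivities of
  the vector to \<open>u\<close>, divided by \<open>A'\<close>; the largest is \<open>U' / \<bar>A'\<bar>\<close>, at the right end.
  The factor \<open>U'\<close> cancels, and the norm is at most \<open>g(U) / (\<alpha> \<bar>g'(U)\<bar>)\<close>
  (\<open>max_norm_deriv_le\<close>).

  It remains to keep \<open>U\<close> in a compact subset of the positive half-line, uniformly in the mesh
  (\<open>flux_bounds\<close>). The trapezoidal sum is at most \<open>g\<^sub>1(U)\<close>. Conversely both \<open>g\<^sub>1(u)\<close> and \<open>U - u\<close> are at
  most \<open>T\<close>, so that convexity gives \<open>g\<^sub>1(U) \<le> g\<^sub>1(u) + g\<^sub>1'(U) (U - u) \<le> (1 + g\<^sub>1'(U)) T\<close>. Hence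
  \<open>\<alpha> \<le> g(U) \<le> (1 + g\<^sub>1'(U)) \<alpha>\<close>; the first inequality bounds \<open>U\<close> from above, and then the second
  bounds it from below.
\<close>

section \<open>Convex nonlinearities\<close>

text \<open>A nonlinearity that vanishes at the origin and is increasing and convex on the positive
  half-line; the continuous derivative \<open>f'\<close> is a parameter of its own.\<close>

locale convex_nonlinearity =
  fixes f f' :: "real \<Rightarrow> real"
  assumes deriv_f: "(f has_real_derivative f' x) (at x)"
    and cont_f': "continuous_on UNIV f'"
    and f_0: "f 0 = 0"
    and f'_pos: "x > 0 \<Longrightarrow> f' x > 0"
    and f'_mono: "0 < x \<Longrightarrow> x \<le> y \<Longrightarrow> f' x \<le> f' y"
begin

lemma cont_f: "continuous_on UNIV f"
  using deriv_f DERIV_isCont continuous_at_imp_continuous_on by blast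

lemma f_pos:
  assumes "x > 0" shows "f x > 0"
proof -
  obtain z where "0 < z" "z < x" "f x - f 0 = (x - 0) * f' z"
    using MVT2[of 0 x f f'] deriv_f assms by auto
  with f'_pos[of z] assms f_0 show ?thesis by simp
qed

lemma f_increment:
  assumes "0 < x" "x \<le> y"
  shows f_mono: "f x \<le> f y" and f_tangent: "f y - f x \<le> f' y * (y - x)"
proof -
  have "f x \<le> f y \<and> f y - f x \<le> f' y * (y - x)"
  proof (cases "x = y")
    case False
    then have "x < y" using assms by simp
    then obtain z where z: "x < z" "z < y" "f y - f x = (y - x) * f' z"
      using MVT2[of x y f f'] deriv_f by auto
    have "f' z > 0" "f' z \<le> f' y"
      using f'_pos[of z] f'_mono[of z y] z assms by auto
    then have "0 \<le> (y - x) * f' z" "(y - x) * f' z \<le> (y - x) * f' y"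
      using \<open>x < y\<close> by (simp_all add: mult_left_mono)
    then show ?thesis using z by (simp add: mult.commute)
  qed simp
  then show "f x \<le> f y" "f y - f x \<le> f' y * (y - x)" by auto
qed

end

lemma admissible_imp_convex_nonlinearity:
  assumes "admissible f"
  shows "convex_nonlinearity f (deriv f)"
proof
  have diff: "((deriv ^^ j) f) field_differentiable (at x)" if "j < 3" for j x
    using assms that by (auto simp: admissible_def C3_def)
  have diff0: "f field_differentiable (at x)" and diff1: "deriv f field_differentiable (at x)" for x
    using diff[of 0 x] diff[of 1 x] by simp_all
  show "(f has_real_derivative deriv f x) (at x)" for x
    using diff0[of x] by (simp add: field_differentiable_derivI)
  have d1: "(deriv f has_real_derivative deriv (deriv f) x) (at x)" for x
    using diff1[of x] by (simp add: field_differentiable_derivI)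
  show "continuous_on UNIV (deriv f)"
    using d1 DERIV_isCont continuous_at_imp_continuous_on by blast
  show "f 0 = 0" "\<And>x. x > 0 \<Longrightarrow> deriv f x > 0"
    using assms by (auto simp: admissible_def)
  have "deriv (deriv f) x > 0" if "x > 0" for x
    using assms that by (auto simp: admissible_def numeral_2_eq_2)
  then show "deriv f x \<le> deriv f y" if "0 < x" "x \<le> y" for x y
    using DERIV_nonneg_imp_nondecreasing[of x y "deriv f"] d1 that
    by (metis less_le_trans less_imp_le)
qed

section \<open>Shooting from the left end\<close>

text \<open>\<open>shot f h u\<close> solves every equation except the last one, with left value \<open>u\<close>;
  its index starts at 0, so that \<open>shot f h u k\<close> is the unknown number \<open>k + 1\<close>.
  \<open>slope f h u k\<close> is the difference quotient of \<open>shot\<close> between the indices \<open>k\<close> and \<open>k + 1\<close>.\<close>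

fun shot slope :: "(real \<Rightarrow> real) \<Rightarrow> real \<Rightarrow> real \<Rightarrow> nat \<Rightarrow> real" where
  "shot f h u 0 = u"
| "shot f h u (Suc k) = shot f h u k + h * slope f h u k"
| "slope f h u 0 = h / 2 * f u"
| "slope f h u (Suc k) = slope f h u k + h * f (shot f h u k + h * slope f h u k)"

text \<open>The derivatives of \<open>shot\<close> and \<open>slope\<close> with respect to the left value \<open>u\<close>.\<close>

fun dshot dslope ::
    "(real \<Rightarrow> real) \<Rightarrow> (real \<Rightarrow> real) \<Rightarrow> real \<Rightarrow> real \<Rightarrow> nat \<Rightarrow> real" where
  "dshot f f' h u 0 = 1"
| "dshot f f' h u (Suc k) = dshot f f' h u k + h * dslope f f' h u k"
| "dslope f f' h u 0 = h / 2 * f' u"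
| "dslope f f' h u (Suc k) = dslope f f' h u k
     + h * (f' (shot f h u (Suc k)) * (dshot f f' h u k + h * dslope f f' h u k))"

text \<open>The slope at the index \<open>k\<close> itself: it is 0 for \<open>k = 0\<close>, and otherwise the mean of the
  two adjacent difference quotients. It is also the trapezoidal sum of \<open>f\<close> over the indices
  \<open>0, \<dots>, k\<close>. At the right end, the last equation of the system equates it with the parameter
  times the second nonlinearity.\<close>

definition flux :: "(real \<Rightarrow> real) \<Rightarrow> real \<Rightarrow> real \<Rightarrow> nat \<Rightarrow> real" where
  "flux f h u k = slope f h u k - h / 2 * f (shot f h u k)"

text \<open>The derivative of \<open>flux\<close> with respect to \<open>u\<close>.\<close>

definition dflux ::
    "(real \<Rightarrow> real) \<Rightarrow> (real \<Rightarrow> real) \<Rightarrow> real \<Rightarrow> real \<Rightarrow> nat \<Rightarrow> real" where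
  "dflux f f' h u k = dslope f f' h u k - h / 2 * (f' (shot f h u k) * dshot f f' h u k)"

context convex_nonlinearity
begin

lemma shot_slope_has_derivative:
  "((\<lambda>u. shot f h u k) has_real_derivative dshot f f' h u k) (at u) \<and>
   ((\<lambda>u. slope f h u k) has_real_derivative dslope f f' h u k) (at u)"
proof (induction k)
  case 0
  show ?case
    using DERIV_cmult[OF deriv_f[of u], of "h / 2"] by simp
next
  case (Suc k)
  have a: "((\<lambda>u. shot f h u k + h * slope f h u k) has_real_derivative
      dshot f f' h u k + h * dslope f f' h u k) (at u)"
    using Suc by (intro DERIV_add DERIV_cmult) auto
  have "((\<lambda>u. f (shot f h u k + h * slope f h u k)) has_real_derivative
      f' (shot f h u k + h * slope f h u k) * (dshot f f' h u k + h * dslope f f' h u k)) (at u)"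
    by (rule DERIV_chain2[OF deriv_f a])
  then show ?case
    using Suc a by (auto intro!: DERIV_add DERIV_cmult)
qed

lemmas shot_has_derivative = shot_slope_has_derivative[THEN conjunct1]
lemmas slope_has_derivative = shot_slope_has_derivative[THEN conjunct2]

lemma flux_has_derivative:
  "((\<lambda>u. flux f h u k) has_real_derivative dflux f f' h u k) (at u)"
  unfolding flux_def dflux_def
  by (intro DERIV_diff DERIV_cmult DERIV_chain2[OF deriv_f] shot_has_derivative
      slope_has_derivative)

lemma continuous_shot: "continuous_on UNIV (\<lambda>u. shot f h u k)"
  using shot_has_derivative DERIV_isCont continuous_at_imp_continuous_on by blast

lemma continuous_flux: "continuous_on UNIV (\<lambda>u. flux f h u k)"
  using flux_has_derivative DERIV_isCont continuous_at_imp_continuous_on by blast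

lemma continuous_f'_shot: "continuous_on UNIV (\<lambda>u. f' (shot f h u k))"
  using continuous_on_compose2[OF cont_f' continuous_shot] by simp

lemma continuous_dshot_dslope:
  "continuous_on UNIV (\<lambda>u. dshot f f' h u k) \<and> continuous_on UNIV (\<lambda>u. dslope f f' h u k)"
proof (induction k)
  case 0
  show ?case using cont_f' by (auto intro!: continuous_intros)
next
  case (Suc k)
  then show ?case
    using continuous_f'_shot[of h "Suc k"] by (auto intro!: continuous_intros)
qed

lemmas continuous_dshot = continuous_dshot_dslope[THEN conjunct1]

lemma continuous_dflux: "continuous_on UNIV (\<lambda>u. dflux f f' h u k)"
  unfolding dflux_def using continuous_dshot_dslope continuous_f'_shot
  by (intro continuous_intros) auto

lemma shot_0: "shot f h 0 k = 0" "slope f h 0 k = 0"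
  by (induction k) (auto simp: f_0)

context
  fixes h u :: real
  assumes h: "h > 0" and u: "u > 0"
begin

lemma shot_slope_pos: "shot f h u k > 0 \<and> slope f h u k > 0"
proof (induction k)
  case (Suc k)
  then have "shot f h u k + h * slope f h u k > 0" using h by (simp add: add_pos_pos)
  then show ?case using Suc h f_pos by (simp add: add_pos_pos)
qed (use h u f_pos in simp)

lemma shot_pos: "shot f h u k > 0" and slope_pos: "slope f h u k > 0"
  using shot_slope_pos by auto

lemma shot_le_Suc: "shot f h u k \<le> shot f h u (Suc k)"
  using h slope_pos[of k] by simp

lemma shot_ge_left: "u \<le> shot f h u k"
  using lift_Suc_mono_le[of "shot f h u" 0 k] shot_le_Suc by simp

lemma dshot_dslope_pos: "dshot f f' h u k > 0 \<and> dslope f f' h u k > 0"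
proof (induction k)
  case (Suc k)
  then have "dshot f f' h u k + h * dslope f f' h u k > 0" using h by (simp add: add_pos_pos)
  then show ?case using Suc h f'_pos[OF shot_pos[of "Suc k"]] by (simp add: add_pos_pos)
qed (use h u f'_pos in simp)

lemma dshot_pos: "dshot f f' h u k > 0" and dslope_pos: "dslope f f' h u k > 0"
  using dshot_dslope_pos by auto

lemma dshot_mono: "j \<le> k \<Longrightarrow> dshot f f' h u j \<le> dshot f f' h u k"
  using lift_Suc_mono_le[of "dshot f f' h u" j k] h dslope_pos by (simp add: less_imp_le)

text \<open>A discrete form of the Wronskian argument: if \<open>y'' = f y\<close> and \<open>v'' = f' y v\<close>, then
  \<open>f' y v y' - f y v'\<close> has the derivative \<open>f'' y v y'\<^sup>2 \<ge> 0\<close> and vanishes at the left end.\<close>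

lemma wronskian_nonneg:
  "f (shot f h u k) * dslope f f' h u k
     \<le> f' (shot f h u k) * dshot f f' h u k * slope f h u k"
proof (induction k)
  case (Suc k)
  define U D V E where defs: "U = shot f h u k" "D = slope f h u k"
    "V = dshot f f' h u k" "E = dslope f f' h u k"
  define U' where "U' = U + h * D"
  have pos: "U > 0" "D > 0" "V > 0" "E > 0"
    using shot_pos slope_pos dshot_pos dslope_pos by (auto simp: defs)
  have U': "U \<le> U'" using pos h by (simp add: U'_def)
  have "f U * E \<le> f' U * (V * D)" using Suc by (simp add: defs mult.assoc)
  also have "\<dots> \<le> f' U' * (V * D)"
    using f'_mono[OF pos(1) U'] pos by (intro mult_right_mono) auto
  finally have 1: "f U * E \<le> f' U' * (V * D)" .
  have "(f U' - f U) * E \<le> (f' U' * (U' - U)) * E"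
    using f_tangent[OF pos(1) U'] pos by (intro mult_right_mono) auto
  then have "f U' * E \<le> f' U' * (V + h * E) * D"
    using 1 by (simp add: U'_def algebra_simps)
  then have "f U' * (E + h * (f' U' * (V + h * E))) \<le> f' U' * (V + h * E) * (D + h * f U')"
    by (simp add: algebra_simps)
  then show ?case by (simp add: defs U'_def)
qed simp

lemma dflux_le:
  "f (shot f h u k) * dflux f f' h u k
     \<le> f' (shot f h u k) * dshot f f' h u k * flux f h u k"
  using wronskian_nonneg[of k] by (simp add: flux_def dflux_def algebra_simps)

lemma flux_Suc: "flux f h u (Suc k) = slope f h u k + h / 2 * f (shot f h u (Suc k))"
  by (simp add: flux_def algebra_simps)

lemma flux_upper: "flux f h u k \<le> real k * h * f (shot f h u k)"
proof (induction k)
  case (Suc k)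
  have "f (shot f h u k) \<le> f (shot f h u (Suc k))"
    using f_mono shot_pos shot_le_Suc by blast
  then have "(real k + 1 / 2) * h * f (shot f h u k)
      \<le> (real k + 1 / 2) * h * f (shot f h u (Suc k))"
    using h by (intro mult_left_mono) auto
  then show ?case using Suc by (simp only: flux_Suc) (simp add: flux_def algebra_simps)
qed (simp add: flux_def)

lemma flux_lower: "real k * h * f u \<le> flux f h u k"
proof (induction k)
  case (Suc k)
  have "h / 2 * f u \<le> h / 2 * f (shot f h u k)"
    "h / 2 * f u \<le> h / 2 * f (shot f h u (Suc k))"
    using f_mono[OF u shot_ge_left] h by (auto intro!: mult_left_mono simp del: shot.simps)
  then show ?case using Suc
    by (simp only: flux_Suc) (simp add: flux_def algebra_simps)
qed (simp add: flux_def)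

lemma shot_increment_le_flux: "shot f h u k - u \<le> real k * h * flux f h u k"
proof (induction k)
  case (Suc k)
  have "flux f h u k \<le> slope f h u k" "slope f h u k \<le> flux f h u (Suc k)"
    using h f_pos[OF shot_pos[of k]] f_pos[OF shot_pos[of "Suc k"]]
    by (simp_all add: flux_def algebra_simps)
  then have "real k * h * flux f h u k \<le> real k * h * flux f h u (Suc k)"
    "h * slope f h u k \<le> h * flux f h u (Suc k)"
    using h by (auto intro!: mult_left_mono)
  then show ?case using Suc by (simp add: algebra_simps)
qed simp

end

text \<open>On a mesh of total length 1, the flux at the right end is comparable with the value of \<open>f\<close>
  there, with constants that do not involve the number of nodes.\<close>

lemma flux_bounds:
  assumes "u > 0" and "m \<ge> 1"
  shows flux_le_right: "flux f (1 / real m) u m \<le> f (shot f (1 / real m) u m)"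
    and right_le_flux: "f (shot f (1 / real m) u m)
      \<le> (1 + f' (shot f (1 / real m) u m)) * flux f (1 / real m) u m"
proof -
  define h where "h = 1 / real m"
  have h: "h > 0" and mh: "real m * h = 1" using assms by (auto simp: h_def)
  show "flux f (1 / real m) u m \<le> f (shot f (1 / real m) u m)"
    using flux_upper[OF h assms(1), of m] mh by (simp add: h_def)
  let ?U = "shot f h u m"
  have U: "0 < ?U" "u \<le> ?U" using shot_pos[OF h assms(1)] shot_ge_left[OF h assms(1)] by auto
  have "f ?U \<le> f u + f' ?U * (?U - u)" using f_tangent[OF assms(1) U(2)] by simp
  also have "\<dots> \<le> flux f h u m + f' ?U * flux f h u m"
    using flux_lower[OF h assms(1), of m] shot_increment_le_flux[OF h assms(1), of m] mh
      f'_pos[OF U(1)] by (intro add_mono mult_left_mono) auto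
  finally show "f (shot f (1 / real m) u m)
      \<le> (1 + f' (shot f (1 / real m) u m)) * flux f (1 / real m) u m"
    by (simp add: h_def algebra_simps)
qed

end

section \<open>The solution curve\<close>

text \<open>The problem on the nodes \<open>1, \<dots>, m + 1\<close> as a scalar equation for the left value \<open>u\<close>;
  \<open>p\<close> is the nonlinearity in the boundary condition, and \<open>f / p\<close> is a strictly decreasing map of
  the positive half-line onto itself; \<open>quotient_decr\<close> states the sign of its derivative.\<close>

locale decreasing_quotient = f: convex_nonlinearity f f' + p: convex_nonlinearity p p'
  for f f' p p' :: "real \<Rightarrow> real" +
  assumes quotient_surj: "(\<lambda>x. f x / p x) ` {0<..} = {0<..}"
    and quotient_decr: "x > 0 \<Longrightarrow> f' x * p x < f x * p' x"
begin

lemma quotient_less: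
  assumes "0 < x" "x < y"
  shows "f y / p y < f x / p x"
proof (rule DERIV_neg_imp_decreasing[OF assms(2)])
  fix z assume "x \<le> z" "z \<le> y"
  then have z: "z > 0" using assms by simp
  then have "p z > 0" by (rule p.f_pos)
  moreover have "((\<lambda>z. f z / p z) has_real_derivative (f' z * p z - f z * p' z) / (p z * p z)) (at z)"
    using \<open>p z > 0\<close> by (intro DERIV_divide f.deriv_f p.deriv_f) auto
  ultimately show "\<exists>d. ((\<lambda>z. f z / p z) has_real_derivative d) (at z) \<and> d < 0"
    using quotient_decr[OF z] by (intro exI conjI) (auto intro!: divide_neg_pos)
qed

lemma quotient_le_cancel:
  assumes "0 < x" "0 < y" "f y / p y \<le> f x / p x"
  shows "x \<le> y"
  using quotient_less[of y x] assms by force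

lemma quotient_value:
  assumes "c > 0"
  obtains x where "x > 0" "f x / p x = c"
proof -
  have "c \<in> (\<lambda>x. f x / p x) ` {0<..}" using assms by (simp add: quotient_surj)
  then show thesis using that by auto
qed

text \<open>The value of the parameter for which the shot with left value \<open>u\<close> satisfies the boundary
  condition at the right end.\<close>

definition param :: "nat \<Rightarrow> real \<Rightarrow> real" where
  "param m u = flux f (1 / real m) u m / p (shot f (1 / real m) u m)"

text \<open>The derivative of \<open>param\<close> with respect to \<open>u\<close>.\<close>

definition dparam :: "nat \<Rightarrow> real \<Rightarrow> real" where
  "dparam m u =
    (dflux f f' (1 / real m) u m * p (shot f (1 / real m) u m)
      - flux f (1 / real m) u m * (p' (shot f (1 / real m) u m) * dshot f f' (1 / real m) u m))
     / (p (shot f (1 / real m) u m) * p (shot f (1 / real m) u m))"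

context
  fixes m :: nat
  assumes m: "m \<ge> 1"
begin

abbreviation (input) "h \<equiv> 1 / real m"
abbreviation (input) "right u \<equiv> shot f h u m"

lemma h_pos: "h > 0" using m by simp

lemma right_pos: "u > 0 \<Longrightarrow> right u > 0"
  by (rule f.shot_pos[OF h_pos])

lemma flux_pos:
  assumes "u > 0" shows "flux f h u m > 0"
proof -
  have "0 < real m * h * f u" using m f.f_pos[OF assms] by simp
  also have "\<dots> \<le> flux f h u m" by (rule f.flux_lower[OF h_pos assms])
  finally show ?thesis .
qed

lemma param_pos: "u > 0 \<Longrightarrow> param m u > 0"
  using flux_pos p.f_pos right_pos by (simp add: param_def)

lemma param_has_derivative:
  assumes "u > 0"
  shows "(param m has_real_derivative dparam m u) (at u)"
  unfolding param_def[abs_def] dparam_def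
  using less_imp_neq[OF p.f_pos[OF right_pos[OF assms]], symmetric]
  by (intro DERIV_divide f.flux_has_derivative DERIV_chain2[OF p.deriv_f] f.shot_has_derivative) auto

lemma continuous_param: "continuous_on {0<..} (param m)"
  using param_has_derivative DERIV_isCont
  by (intro continuous_at_imp_continuous_on) auto

lemma continuous_dparam: "continuous_on {0<..} (dparam m)"
proof -
  note cont = continuous_on_subset[OF _ subset_UNIV]
  have p: "continuous_on {0<..} (\<lambda>u. p (right u))"
    by (rule continuous_on_compose2[OF p.cont_f cont[OF f.continuous_shot]]) auto
  have p': "continuous_on {0<..} (\<lambda>u. p' (right u))"
    by (rule continuous_on_compose2[OF p.cont_f' cont[OF f.continuous_shot]]) auto
  have nz: "p (right u) * p (right u) \<noteq> 0" if "u \<in> {0<..}" for u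
    using p.f_pos[OF right_pos, of u] that by simp
  show ?thesis
    unfolding dparam_def[abs_def]
    using nz by (intro continuous_on_divide continuous_on_diff continuous_on_mult p p'
        cont[OF f.continuous_dflux] cont[OF f.continuous_flux] cont[OF f.continuous_dshot]) auto
qed

text \<open>The bound \<open>- A' \<ge> A U' (- g'(U) / g(U))\<close> for \<open>A = param\<close>, \<open>g = f / p\<close> and the right
  value \<open>U\<close>, cleared of denominators.\<close>

lemma dshot_le_dparam:
  assumes "u > 0"
  shows "param m u * (f (right u) * p' (right u) - f' (right u) * p (right u)) * dshot f f' h u m
    \<le> f (right u) * p (right u) * (- dparam m u)"
proof -
  define U V T dT where defs: "U = right u" "V = dshot f f' h u m" "T = flux f h u m"
    "dT = dflux f f' h u m"
  have p: "p U > 0" using p.f_pos right_pos assms by (simp add: defs)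
  have "f U * dT \<le> f' U * V * T"
    using f.dflux_le[OF h_pos assms, of m] by (simp add: defs)
  then have "p U * (f U * dT) \<le> p U * (f' U * V * T)" using p by (intro mult_left_mono) auto
  then have "T * (f U * p' U - f' U * p U) * V \<le> f U * (T * (p' U * V) - dT * p U)"
    by (simp add: algebra_simps)
  then have "T * (f U * p' U - f' U * p U) * V / p U \<le> f U * (T * (p' U * V) - dT * p U) / p U"
    using p by (intro divide_right_mono) auto
  then show ?thesis
    using p by (simp add: param_def dparam_def flip: defs) (simp add: field_simps)
qed

lemma dparam_neg:
  assumes "u > 0" shows "dparam m u < 0"
proof -
  have U: "right u > 0" using right_pos assms .
  have "0 < param m u * (f (right u) * p' (right u) - f' (right u) * p (right u)) * dshot f f' h u m"
    using param_pos[OF assms] quotient_decr[OF U] f.dshot_pos[OF h_pos assms, of m] by simp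
  also have "\<dots> \<le> f (right u) * p (right u) * (- dparam m u)"
    by (rule dshot_le_dparam[OF assms])
  finally show ?thesis
    using f.f_pos[OF U] p.f_pos[OF U] by (simp add: zero_less_mult_iff mult_less_0_iff)
qed

lemma param_less: "0 < u \<Longrightarrow> u < v \<Longrightarrow> param m v < param m u"
  by (rule DERIV_neg_imp_decreasing[of u v "param m"])
    (use less_le_trans param_has_derivative dparam_neg in blast)+

lemma param_inj: "inj_on (param m) {0<..}"
  using param_less by (intro linorder_inj_onI) force+

lemma param_bounds:
  assumes "u > 0"
  shows param_le_quotient: "param m u \<le> f (right u) / p (right u)"
    and quotient_le_param: "f (right u) / p (right u) \<le> (1 + f' (right u)) * param m u"
proof -
  have p: "p (right u) > 0" using p.f_pos[OF right_pos[OF assms]] .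
  show "param m u \<le> f (right u) / p (right u)"
    using f.flux_le_right[OF assms m] p by (simp add: param_def divide_right_mono)
  show "f (right u) / p (right u) \<le> (1 + f' (right u)) * param m u"
    using f.right_le_flux[OF assms m] p by (simp add: param_def divide_right_mono)
qed

lemma right_le:
  assumes "u > 0" "b > 0" "f b / p b \<le> param m u"
  shows "right u \<le> b"
  using quotient_le_cancel[OF right_pos[OF assms(1)] assms(2)] param_le_quotient[OF assms(1)] assms(3)
  by simp

text \<open>The parameter is at least a fixed fraction of the quotient at the right value, and the quotient
  is large near 0; so a bounded parameter keeps the right value away from 0.\<close>

lemma right_ge:
  assumes "u > 0" "a > 0" "right u \<le> b" "(1 + f' b) * param m u \<le> f a / p a"
  shows "a \<le> right u"
proof (rule quotient_le_cancel[OF assms(2) right_pos[OF assms(1)]])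
  have "f' (right u) \<le> f' b" using f.f'_mono[OF right_pos[OF assms(1)] assms(3)] .
  then have "(1 + f' (right u)) * param m u \<le> (1 + f' b) * param m u"
    using param_pos[OF assms(1)] by (intro mult_right_mono) auto
  then show "f (right u) / p (right u) \<le> f a / p a"
    using quotient_le_param[OF assms(1)] assms(4) by simp
qed

lemma param_surj:
  assumes "\<alpha> > 0"
  obtains u where "u > 0" "param m u = \<alpha>"
proof -
  obtain b where b: "b > 0" "f b / p b = \<alpha>" using quotient_value[OF assms] .
  \<comment> \<open>The parameter is at most \<open>\<alpha>\<close> for the left value \<open>b\<close>, and at least \<open>\<alpha>\<close> once the right
    value is below \<open>min a b\<close>; the latter holds for small left values by continuity.\<close>
  have "b \<le> right b" by (rule f.shot_ge_left[OF h_pos b(1)])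
  then have "f (right b) / p (right b) \<le> f b / p b"
    using quotient_less[of b "right b"] b by (cases "b = right b") auto
  then have le: "param m b \<le> \<alpha>" using param_le_quotient[OF b(1)] b by simp
  have "(1 + f' b) * \<alpha> > 0" using f.f'_pos[OF b(1)] assms by (simp add: add_pos_pos)
  then obtain a where a: "a > 0" "f a / p a = (1 + f' b) * \<alpha>" by (rule quotient_value)
  have "\<forall>\<^sub>F u in at_right 0. right u < min a b"
  proof (rule order_tendstoD)
    have "isCont (\<lambda>u. right u) 0"
      using f.shot_has_derivative DERIV_isCont by blast
    then show "((\<lambda>u. right u) \<longlongrightarrow> 0) (at_right 0)"
      by (simp add: isCont_def f.shot_0 filterlim_at_split)
  qed (use a b in simp)
  then obtain c where c: "c > 0" "\<And>u. 0 < u \<Longrightarrow> u < c \<Longrightarrow> right u < min a b"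
    unfolding eventually_at_right_field by auto
  define u where "u = min (c / 2) b"
  have u: "u > 0" "u < c" "u \<le> b" using c(1) b(1) by (auto simp: u_def)
  have "right u < a" "right u \<le> b" using c(2)[OF u(1,2)] by auto
  then have "\<not> (1 + f' b) * param m u \<le> f a / p a"
    using right_ge[OF u(1) a(1)] by force
  then have "(1 + f' b) * \<alpha> < (1 + f' b) * param m u" using a by simp
  then have ge: "\<alpha> \<le> param m u"
    using f.f'_pos[OF b(1)] by (simp add: mult_less_cancel_left)
  have "continuous_on {u..b} (param m)"
    by (rule continuous_on_subset[OF continuous_param]) (use u in auto)
  then obtain x where "u \<le> x" "x \<le> b" "param m x = \<alpha>"
    using IVT2'[of "param m" b \<alpha> u] le ge u(3) by auto
  then show thesis using that[of x] u by simp
qed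

text \<open>The left value of the positive solution for the parameter \<open>\<alpha>\<close>; meaningful for \<open>\<alpha> > 0\<close>
  only.\<close>

definition left_value :: "real \<Rightarrow> real" where
  "left_value = inv_into {0<..} (param m)"

lemma left_value:
  assumes "\<alpha> > 0"
  shows left_value_pos: "left_value \<alpha> > 0" and param_left_value: "param m (left_value \<alpha>) = \<alpha>"
proof -
  have "\<alpha> \<in> param m ` {0<..}" using param_surj[OF assms] by force
  then show "left_value \<alpha> > 0" "param m (left_value \<alpha>) = \<alpha>"
    using inv_into_into[of \<alpha> "param m" "{0<..}"] f_inv_into_f[of \<alpha> "param m" "{0<..}"]
    by (auto simp: left_value_def)
qed

lemma left_value_param: "u > 0 \<Longrightarrow> left_value (param m u) = u"
  unfolding left_value_def using param_inj by (intro inv_into_f_f) auto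

lemma left_value_has_derivative:
  assumes "\<alpha> > 0"
  shows "(left_value has_real_derivative 1 / dparam m (left_value \<alpha>)) (at \<alpha>)"
proof -
  let ?u = "left_value \<alpha>"
  have u: "?u > 0" "param m ?u = \<alpha>" using left_value[OF assms] .
  have nz: "dparam m ?u \<noteq> 0" using dparam_neg[OF u(1)] by simp
  have "(left_value has_derivative (*) (1 / dparam m ?u)) (at (param m ?u))"
  proof (rule has_derivative_inverse_strong[where f = "param m" and x = ?u and S = "{0<..}"])
    show "(param m has_derivative (*) (dparam m ?u)) (at ?u)"
      using param_has_derivative[OF u(1)] by (simp add: has_field_derivative_def)
    show "(*) (dparam m ?u) \<circ> (*) (1 / dparam m ?u) = id" using nz by auto
  qed (use u continuous_param left_value_param in auto)
  then show ?thesis by (simp add: has_field_derivative_def u)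
qed

lemma continuous_left_value: "continuous_on {0<..} left_value"
  using left_value_has_derivative DERIV_isCont
  by (intro continuous_at_imp_continuous_on) auto

lemma mesh_Suc: "mesh (Suc m) = h"
  by (simp add: mesh_def)

text \<open>The first \<open>m\<close> equations of the \<open>m + 1\<close> say that the vector is a shot, and the last one fixes the
  parameter.\<close>

lemma system_solution_iff:
  assumes pos: "\<And>k. k \<in> {1..Suc m} \<Longrightarrow> U k > 0"
  shows "system_solution f p (Suc m) \<alpha> U \<longleftrightarrow>
    (\<forall>k\<le>m. U (Suc k) = shot f h (U 1) k) \<and> param m (U 1) = \<alpha>"
    (is "?sys \<longleftrightarrow> ?shot \<and> ?par")
proof -
  have U1: "U 1 > 0" using pos[of 1] by simp
  have last: "?sys \<longleftrightarrow> ?par" if shot: ?shot and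
    first: "\<forall>k\<in>{2..m}. 0 = - (U (k + 1) - 2 * U k + U (k - 1)) + h\<^sup>2 * f (U k)"
      "0 = - (U 2 - U 1) + h\<^sup>2 / 2 * f (U 1)"
  proof -
    obtain j where j: "m = Suc j" using m by (cases m) auto
    have "j \<le> m" using j by simp
    then have Um: "U (Suc m) = right (U 1)" "U m = shot f h (U 1) j"
      unfolding j using shot[rule_format, of j] shot[rule_format, of m] j by blast+
    have "U m = right (U 1) - h * slope f h (U 1) j" using Um(2) by (simp add: j)
    also have "slope f h (U 1) j = flux f h (U 1) m - h / 2 * f (right (U 1))"
      using f.flux_Suc[OF h_pos U1, of j] j by simp
    finally have "- (U m - U (Suc m)) + h\<^sup>2 / 2 * f (U (Suc m)) - h * \<alpha> * p (U (Suc m))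
        = h * (flux f h (U 1) m - \<alpha> * p (right (U 1)))"
      using Um(1) by (simp add: power2_eq_square algebra_simps)
    then have "?sys \<longleftrightarrow> flux f h (U 1) m = \<alpha> * p (right (U 1))"
      using first h_pos by (simp add: system_solution_def mesh_Suc)
    also have "\<dots> \<longleftrightarrow> ?par"
      using p.f_pos[OF right_pos[OF U1]] by (auto simp: param_def field_simps)
    finally show ?thesis .
  qed
  show ?thesis
  proof
    assume sys: ?sys
    then have first: "\<forall>k\<in>{2..m}. 0 = - (U (k + 1) - 2 * U k + U (k - 1)) + h\<^sup>2 * f (U k)"
      "0 = - (U 2 - U 1) + h\<^sup>2 / 2 * f (U 1)"
      by (auto simp: system_solution_def mesh_Suc)
    have "U (Suc k) = shot f h (U 1) k \<and>
        (Suc k \<le> m \<longrightarrow> U (Suc (Suc k)) - U (Suc k) = h * slope f h (U 1) k)" if "k \<le> m" for k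
      using that
    proof (induction k)
      case 0
      then show ?case using first(2) by (simp add: power2_eq_square numeral_2_eq_2)
    next
      case (Suc k)
      then have IH: "U (Suc k) = shot f h (U 1) k"
        "U (Suc (Suc k)) - U (Suc k) = h * slope f h (U 1) k" by auto
      then have U: "U (Suc (Suc k)) = shot f h (U 1) (Suc k)" by simp
      have "U (Suc (Suc (Suc k))) - U (Suc (Suc k)) = h * slope f h (U 1) (Suc k)"
        if "Suc (Suc k) \<le> m"
      proof -
        have "Suc (Suc k) \<in> {2..m}" using that by auto
        with first(1) have "0 = - (U (Suc (Suc k) + 1) - 2 * U (Suc (Suc k)) + U (Suc (Suc k) - 1))
            + h\<^sup>2 * f (U (Suc (Suc k)))" by blast
        then have "U (Suc (Suc (Suc k))) - U (Suc (Suc k))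
            = (U (Suc (Suc k)) - U (Suc k)) + h * (h * f (U (Suc (Suc k))))"
          by (simp add: power2_eq_square)
        also have "\<dots> = h * (slope f h (U 1) k + h * f (shot f h (U 1) (Suc k)))"
          using IH(2) U by (simp only: distrib_left)
        finally show ?thesis by simp
      qed
      then show ?case using U by blast
    qed
    then have ?shot by blast
    then show "?shot \<and> ?par" using last[OF _ first] sys by blast
  next
    assume "?shot \<and> ?par"
    then have shot: "U (Suc k) = shot f h (U 1) k" if "k \<le> m" for k using that by blast
    have "0 = - (U (k + 1) - 2 * U k + U (k - 1)) + h\<^sup>2 * f (U k)" if k: "k \<in> {2..m}" for k
    proof -
      obtain j where j: "k = Suc (Suc j)"
        using k by (metis atLeastAtMost_iff add_2_eq_Suc le_Suc_ex)
      have "U (k + 1) = shot f h (U 1) (Suc (Suc j))" "U k = shot f h (U 1) (Suc j)"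
        "U (k - 1) = shot f h (U 1) j"
        using shot[of "Suc (Suc j)"] shot[of "Suc j"] shot[of j] k by (simp_all add: j)
      then show ?thesis by (simp add: power2_eq_square algebra_simps)
    qed
    moreover have "0 = - (U 2 - U 1) + h\<^sup>2 / 2 * f (U 1)"
      using shot[of 1] m by (simp add: numeral_2_eq_2 power2_eq_square)
    ultimately show ?sys using last \<open>?shot \<and> ?par\<close> by blast
  qed
qed

lemma positive_solution_eq:
  assumes "\<alpha> > 0"
  shows "positive_solution f p (Suc m) \<alpha>
    = (\<lambda>k\<in>{1..Suc m}. shot f h (left_value \<alpha>) (k - 1))" (is "_ = ?S")
  unfolding positive_solution_def
proof (rule the_equality)
  have pos: "?S k > 0" if "k \<in> {1..Suc m}" for k
    using that f.shot_pos[OF h_pos left_value_pos[OF assms]] by simp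
  have "system_solution f p (Suc m) \<alpha> ?S"
    by (subst system_solution_iff[OF pos]) (use param_left_value[OF assms] in auto)
  then show "?S \<in> {1..Suc m} \<rightarrow>\<^sub>E {0<..} \<and> system_solution f p (Suc m) \<alpha> ?S"
    using pos by auto
next
  fix U assume U: "U \<in> {1..Suc m} \<rightarrow>\<^sub>E {0<..} \<and> system_solution f p (Suc m) \<alpha> U"
  have pos: "U k > 0" if "k \<in> {1..Suc m}" for k
    using PiE_mem[OF U[THEN conjunct1] that] by simp
  have sol: "(\<forall>k\<le>m. U (Suc k) = shot f h (U 1) k) \<and> param m (U 1) = \<alpha>"
    by (rule system_solution_iff[THEN iffD1]) (fact pos, rule U[THEN conjunct2])
  have left: "left_value \<alpha> = U 1"
    using left_value_param[OF pos[of 1]] sol[THEN conjunct2] by simp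
  show "U = ?S"
  proof (rule PiE_ext)
    show "U \<in> {1..Suc m} \<rightarrow>\<^sub>E {0<..}" using U by simp
    show "?S \<in> {1..Suc m} \<rightarrow>\<^sub>E {0<..}"
      using f.shot_pos[OF h_pos left_value_pos[OF assms]] by auto
    fix k assume "k \<in> {1..Suc m}"
    then have k: "k - 1 \<le> m" "Suc (k - 1) = k" by auto
    then have "U k = shot f h (U 1) (k - 1)"
      using sol[THEN conjunct1, rule_format, OF k(1)] unfolding k(2) by simp
    then show "U k = ?S k" using \<open>k \<in> {1..Suc m}\<close> by (simp add: left)
  qed
qed

lemma positive_solution_deriv_eq:
  assumes "\<alpha> > 0" "k \<in> {1..Suc m}"
  shows "positive_solution_deriv f p (Suc m) \<alpha> k
    = dshot f f' h (left_value \<alpha>) (k - 1) / dparam m (left_value \<alpha>)"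
proof -
  have "\<forall>\<^sub>F a in nhds \<alpha>. a \<in> {0<..}"
    using assms(1) by (intro eventually_nhds_in_open) auto
  then have ev: "\<forall>\<^sub>F a in nhds \<alpha>.
      positive_solution f p (Suc m) a k = shot f h (left_value a) (k - 1)"
    by eventually_elim (use positive_solution_eq assms(2) in auto)
  have "((\<lambda>a. shot f h (left_value a) (k - 1)) has_real_derivative
      dshot f f' h (left_value \<alpha>) (k - 1) * (1 / dparam m (left_value \<alpha>))) (at \<alpha>)"
    by (rule DERIV_chain2[OF f.shot_has_derivative left_value_has_derivative[OF assms(1)]])
  then have "((\<lambda>a. positive_solution f p (Suc m) a k) has_real_derivative
      dshot f f' h (left_value \<alpha>) (k - 1) * (1 / dparam m (left_value \<alpha>))) (at \<alpha>)"
    by (subst DERIV_cong_ev[OF refl ev refl])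
  then show ?thesis
    using assms(2) by (simp add: positive_solution_deriv_def DERIV_imp_deriv)
qed

text \<open>The sensitivity is largest at the right end.\<close>

lemma max_norm_deriv:
  assumes "\<alpha> > 0"
  shows "max_norm (Suc m) (positive_solution_deriv f p (Suc m) \<alpha>)
    = dshot f f' h (left_value \<alpha>) m / (- dparam m (left_value \<alpha>))"
proof -
  let ?u = "left_value \<alpha>"
  have u: "?u > 0" using left_value_pos[OF assms] .
  have neg: "dparam m ?u < 0" using dparam_neg[OF u] .
  have abs: "\<bar>positive_solution_deriv f p (Suc m) \<alpha> k\<bar> = dshot f f' h ?u (k - 1) / (- dparam m ?u)"
    if "k \<in> {1..Suc m}" for k
    using positive_solution_deriv_eq[OF assms that] f.dshot_pos[OF h_pos u, of "k - 1"] neg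
    by (simp add: abs_div_pos abs_divide)
  show ?thesis
    unfolding max_norm_def
  proof (rule Max_eqI)
    fix y assume "y \<in> (\<lambda>k. \<bar>positive_solution_deriv f p (Suc m) \<alpha> k\<bar>) ` {1..Suc m}"
    then obtain k where k: "k \<in> {1..Suc m}" "y = \<bar>positive_solution_deriv f p (Suc m) \<alpha> k\<bar>" by auto
    have "dshot f f' h ?u (k - 1) \<le> dshot f f' h ?u m"
      using k by (intro f.dshot_mono[OF h_pos u]) auto
    then show "y \<le> dshot f f' h ?u m / (- dparam m ?u)"
      unfolding k(2) abs[OF k(1)] using neg by (intro divide_right_mono) auto
  next
    show "dshot f f' h ?u m / (- dparam m ?u)
        \<in> (\<lambda>k. \<bar>positive_solution_deriv f p (Suc m) \<alpha> k\<bar>) ` {1..Suc m}"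
      using abs[of "Suc m"] by (intro image_eqI[of _ _ "Suc m"]) auto
  qed simp
qed

lemma max_norm_deriv_continuous:
  "continuous_on {0<..} (\<lambda>\<alpha>. max_norm (Suc m) (positive_solution_deriv f p (Suc m) \<alpha>))"
proof -
  have "continuous_on {0<..} (\<lambda>\<alpha>. dshot f f' h (left_value \<alpha>) m)"
    by (rule continuous_on_compose2[OF f.continuous_dshot continuous_left_value]) auto
  moreover have "continuous_on {0<..} (\<lambda>\<alpha>. dparam m (left_value \<alpha>))"
    by (rule continuous_on_compose2[OF continuous_dparam continuous_left_value])
      (use left_value_pos in auto)
  ultimately have "continuous_on {0<..}
      (\<lambda>\<alpha>. dshot f f' h (left_value \<alpha>) m / (- dparam m (left_value \<alpha>)))"
    using dparam_neg left_value_pos by (intro continuous_intros) force+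
  then show ?thesis by (rule continuous_on_eq) (simp add: max_norm_deriv)
qed

lemma max_norm_deriv_le:
  assumes "\<alpha> > 0"
  shows "\<alpha> * max_norm (Suc m) (positive_solution_deriv f p (Suc m) \<alpha>)
    \<le> f (right (left_value \<alpha>)) * p (right (left_value \<alpha>))
      / (f (right (left_value \<alpha>)) * p' (right (left_value \<alpha>))
         - f' (right (left_value \<alpha>)) * p (right (left_value \<alpha>)))"
proof -
  let ?u = "left_value \<alpha>"
  have u: "?u > 0" using left_value_pos[OF assms] .
  show ?thesis
    using dshot_le_dparam[OF u] dparam_neg[OF u] quotient_decr[OF right_pos[OF u]]
    by (simp add: max_norm_deriv[OF assms] param_left_value[OF assms] field_simps)
qed

end

text \<open>The right values of the positive solutions for all mesh sizes lie in a common compact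
  subset of the positive half-line.\<close>

lemma max_norm_deriv_uniform_bound:
  assumes "0 < \<alpha>0" "\<alpha>0 \<le> \<alpha>1"
  obtains K where "\<And>m \<alpha>. m \<ge> 1 \<Longrightarrow> \<alpha> \<in> {\<alpha>0..\<alpha>1} \<Longrightarrow>
    max_norm (Suc m) (positive_solution_deriv f p (Suc m) \<alpha>) \<le> K"
proof -
  obtain b where b: "b > 0" "f b / p b = \<alpha>0" using quotient_value[OF assms(1)] .
  have "(1 + f' b) * \<alpha>1 > 0" using f.f'_pos[OF b(1)] assms by (simp add: add_pos_pos)
  then obtain a where a: "a > 0" "f a / p a = (1 + f' b) * \<alpha>1" by (rule quotient_value)
  \<comment> \<open>The right values lie in \<open>{a..b}\<close>, and the choice of \<open>a\<close> and \<open>b\<close> does not involve \<open>m\<close>.\<close>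
  define q where "q x = f x * p x / (f x * p' x - f' x * p x)" for x
  have "f x * p' x - f' x * p x \<noteq> 0" if "x \<in> {a..b}" for x
    using quotient_decr[of x] a(1) that by auto
  then have "continuous_on {a..b} q"
    unfolding q_def
    by (intro continuous_intros continuous_on_subset[OF f.cont_f] continuous_on_subset[OF p.cont_f]
        continuous_on_subset[OF f.cont_f'] continuous_on_subset[OF p.cont_f']) auto
  then have "bounded (q ` {a..b})"
    by (intro compact_imp_bounded compact_continuous_image) auto
  then obtain B where B: "\<forall>x\<in>{a..b}. \<bar>q x\<bar> \<le> B"
    unfolding bounded_iff by auto
  show thesis
  proof (rule that[of "B / \<alpha>0"])
    fix m :: nat and \<alpha> assume m: "m \<ge> 1" and "\<alpha> \<in> {\<alpha>0..\<alpha>1}"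
    then have \<alpha>: "\<alpha> > 0" "\<alpha>0 \<le> \<alpha>" "\<alpha> \<le> \<alpha>1" using assms by auto
    let ?N = "max_norm (Suc m) (positive_solution_deriv f p (Suc m) \<alpha>)"
    define u where "u = left_value m \<alpha>"
    have u: "u > 0" "param m u = \<alpha>" using left_value[OF m \<alpha>(1)] by (auto simp: u_def)
    define U where "U = shot f (1 / real m) u m"
    have "U \<le> b" using right_le[OF m u(1) b(1)] b u \<alpha> by (simp add: U_def)
    moreover have "a \<le> U"
    proof -
      have "(1 + f' b) * \<alpha> \<le> (1 + f' b) * \<alpha>1"
        using f.f'_pos[OF b(1)] \<alpha> by (intro mult_left_mono) auto
      then show ?thesis
        using right_ge[OF m u(1) a(1), of b] \<open>U \<le> b\<close> a u by (simp add: U_def)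
    qed
    ultimately have "q U \<le> B" using B by force
    moreover have "\<alpha> * ?N \<le> q U"
      using max_norm_deriv_le[OF m \<alpha>(1)] by (simp add: q_def U_def u_def)
    moreover have "?N > 0"
      using max_norm_deriv[OF m \<alpha>(1)] f.dshot_pos[OF h_pos[OF m] u(1), of m] dparam_neg[OF m u(1)]
      by (simp add: u_def divide_pos_neg)
    then have "\<alpha>0 * ?N \<le> \<alpha> * ?N" using \<alpha> by (intro mult_right_mono) auto
    ultimately show "?N \<le> B / \<alpha>0" using assms by (simp add: field_simps)
  qed
qed

end

section \<open>The uniform bound\<close>

theorem theorem14:
  fixes g1 g2 :: "real \<Rightarrow> real" and \<alpha>l \<alpha>u :: real
  assumes "admissible g1" and "admissible g2"
    and "\<alpha>l > 0" and "\<alpha>u > 0"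
    and "(\<lambda>x. g1 x / g2 x) ` {0<..} = {0<..}"
    and "\<forall>x>0. deriv (\<lambda>x. g1 x / g2 x) x < 0"
  shows "\<exists>\<kappa>1>0. \<forall>n\<ge>2. \<exists>\<kappa>.
           is_maximum ((\<lambda>\<alpha>. max_norm n (positive_solution_deriv g1 g2 n \<alpha>)) ` closed_segment \<alpha>l \<alpha>u) \<kappa> \<and>
           \<kappa> < \<kappa>1"
proof -
  interpret f: convex_nonlinearity g1 "deriv g1"
    using assms(1) by (rule admissible_imp_convex_nonlinearity)
  interpret p: convex_nonlinearity g2 "deriv g2"
    using assms(2) by (rule admissible_imp_convex_nonlinearity)
  interpret decreasing_quotient g1 "deriv g1" g2 "deriv g2"
  proof
    show "(\<lambda>x. g1 x / g2 x) ` {0<..} = {0<..}" by (rule assms(5))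
    fix x :: real assume "x > 0"
    then have pos: "g2 x > 0" by (rule p.f_pos)
    then have "((\<lambda>x. g1 x / g2 x) has_real_derivative
        (deriv g1 x * g2 x - g1 x * deriv g2 x) / (g2 x * g2 x)) (at x)"
      by (intro DERIV_divide f.deriv_f p.deriv_f) auto
    then have "(deriv g1 x * g2 x - g1 x * deriv g2 x) / (g2 x * g2 x) < 0"
      using assms(6) \<open>x > 0\<close> DERIV_imp_deriv by fastforce
    then show "deriv g1 x * g2 x < g1 x * deriv g2 x"
      using pos by (simp add: divide_less_0_iff zero_less_mult_iff)
  qed
  have seg: "closed_segment \<alpha>l \<alpha>u = {min \<alpha>l \<alpha>u..max \<alpha>l \<alpha>u}"
    by (auto simp: closed_segment_eq_real_ivl)
  let ?N = "\<lambda>n \<alpha>. max_norm n (positive_solution_deriv g1 g2 n \<alpha>)"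
  have "0 < min \<alpha>l \<alpha>u" "min \<alpha>l \<alpha>u \<le> max \<alpha>l \<alpha>u" using assms(3,4) by auto
  then obtain K where K: "\<And>m \<alpha>. m \<ge> 1 \<Longrightarrow> \<alpha> \<in> closed_segment \<alpha>l \<alpha>u \<Longrightarrow> ?N (Suc m) \<alpha> \<le> K"
    using max_norm_deriv_uniform_bound unfolding seg by metis
  \<comment> \<open>\<open>K\<close> itself need not be a strict bound.\<close>
  have "\<exists>\<kappa>. is_maximum (?N n ` closed_segment \<alpha>l \<alpha>u) \<kappa> \<and> \<kappa> < \<bar>K\<bar> + 1" if "n \<ge> 2" for n
  proof -
    obtain m where m: "n = Suc m" "m \<ge> 1" using \<open>n \<ge> 2\<close> by (cases n) auto
    have "closed_segment \<alpha>l \<alpha>u \<subseteq> {0<..}" using assms(3,4) by (auto simp: seg)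
    then have "continuous_on (closed_segment \<alpha>l \<alpha>u) (?N n)"
      using max_norm_deriv_continuous[OF m(2)] m(1) continuous_on_subset by blast
    then obtain \<alpha> where \<alpha>: "\<alpha> \<in> closed_segment \<alpha>l \<alpha>u"
        "\<forall>\<beta>\<in>closed_segment \<alpha>l \<alpha>u. ?N n \<beta> \<le> ?N n \<alpha>"
      using continuous_attains_sup[of "closed_segment \<alpha>l \<alpha>u" "?N n"] by auto
    have "?N n \<alpha> < \<bar>K\<bar> + 1" using K[OF m(2) \<alpha>(1)] m(1) by simp
    then show ?thesis using \<alpha> by (auto simp: is_maximum_def)
  qed
  then show ?thesis by (intro exI[of _ "\<bar>K\<bar> + 1"]) auto
qed

end
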